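(* Let $j\in\{2,3,4,5,7\}$ and let $\frac{\lambda}{\mu}\in \bar{\mathcal{I}}_n^{\{1,j\}}$. If $\pi = g(\frac{\lambda}{\mu})$, then \[\operatorname{ind}\left(\frac{\lambda}{\mu}\right)=\frac{N_{o}(\pi)}{2}+1,\] where $N_{o}(\pi)$ is the number of odd entries of the displacement list $d(\pi)$ of $\pi$.
   Context: A composition of $n$ is an ordered list of positive integers (parts) with sum $n$. A meander on $n$ nodes is a pair $\frac{\lambda}{\mu}$ of compositions of $n$, viewed as a planar (multi)graph on vertices $1,\dots,n$: for each part $a$ of $\lambda$, occupying the consecutive vertices $p+1,\dots,p+a$ (where $p$ is the sum of the preceding parts), there is an upper edge joining $p+i$ and $p+a+1-i$ for each $1\le i\le \lfloor a/2\rfloor$; lower edges are defined in the same way from $\mu$. If the same two vertices are joined by both an upper and a lower edge, both edges are kept and form a cycle. Every connected component is a cycle or a path (an isolated vertex counts as a path). The index is $\operatorname{ind}(\frac{\lambda}{\mu}) = 2c+p$, where $c$ is the number of cycles and $p$ is the number of paths (this equals the index of the associated seaweed subalgebra of $\mathfrak{gl}_n$). $PS(\lambda)$ denotes the set of partial sums $\{\lambda_1,\lambda_1+\lambda_2,\dots,n\}$. A meander is indecomposable if it is not a direct sum (concatenation of upper and of lower compositions) of strictly smaller nonempty meanders; equivalently $PS(\lambda)\cap PS(\mu)=\{n\}$. $\bar{\mathcal{I}}_n^{\{1,j\}}$ is the set of indecomposable meanders $\frac{\lambda}{\mu}$ on $n$ nodes with all parts in $\{1,j\}$ and $\lambda_1>\mu_1$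 (so $\lambda_1=j$, $\mu_1=1$). The displacement list of a permutation $\pi=\pi_1\cdots\pi_m$ is $d(\pi)=(\pi_1-1,\dots,\pi_m-m)$. The map $g$ sends $\frac{\lambda}{\mu}\in\bar{\mathcal{I}}_n^{\{1,j\}}$ to a permutation $\pi$ of $\{1,\dots,n-1\}$ with all displacements in $\{-2,-1,j-2\}$, via its displacement list $(d_1,\dots,d_{n-1})$ (that is, $\pi_i=d_i+i$), constructed as follows. For each $m\in\{1,\dots,n-1\}$ with $m\notin PS(\lambda)\cup PS(\mu)$, set $d_{m+1}=-2$. Set $d_1=j-2$, set a state tracker last_j to be $\lambda$, and mark $\lambda_1=j$ and $\mu_1=1$ as read. Then, while some $d_i$ with $2\le i\le n-1$ is unassigned, look at the next unread part (from left to right) of the composition opposite last_j (i.e. $\mu$ if last_j is $\lambda$, and $\lambda$ if last_j is $\mu$), and mark it as read: if it is $1$, set the earliest unassigned $d_i$ to $-1$; if it is $j$, set the earliest unassigned $d_i$ to $j-2$ and change last_j to the composition containing this part. (The final part $1$ is left over and contributes nothing.) *)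

theory Defs
  imports Complex_Main "HOL-Library.Multiset"
begin

section \<open>Compositions and meanders\<close>

definition is_composition :: "nat \<Rightarrow> nat list \<Rightarrow> bool" where
  "is_composition n as \<longleftrightarrow> (\<forall>a\<in>set as. 0 < a) \<and> sum_list as = n"

definition PS :: "nat list \<Rightarrow> nat set" where
  "PS as = {sum_list (take k as) | k. 1 \<le> k \<and> k \<le> length as}"

text \<open>The meander is the pair (\<open>lam\<close>, \<open>mu\<close>): \<open>lam\<close> is the upper composition, \<open>mu\<close> the lower one.\<close>

definition is_meander :: "nat \<Rightarrow> nat list \<Rightarrow> nat list \<Rightarrow> bool" where
  "is_meander n lam mu \<longleftrightarrow> is_composition n lam \<and> is_composition n mu"

definition indecomposable :: "nat \<Rightarrow> nat list \<Rightarrow> nat list \<Rightarrow> bool" where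
  "indecomposable n lam mu \<longleftrightarrow>
     \<not> (\<exists>n1 n2 lam1 lam2 mu1 mu2.
          0 < n1 \<and> 0 < n2 \<and> n = n1 + n2 \<and>
          is_meander n1 lam1 mu1 \<and> is_meander n2 lam2 mu2 \<and>
          lam = lam1 @ lam2 \<and> mu = mu1 @ mu2)"

lemma composition_split:
  assumes "is_composition n as" "s \<in> PS as" "s \<noteq> n"
  obtains as1 as2 where "as = as1 @ as2" "is_composition s as1" "is_composition (n - s) as2"
    "0 < s" "s < n"
proof -
  obtain k where k: "1 \<le> k" "k \<le> length as" "s = sum_list (take k as)"
    using assms(2) by (auto simp: PS_def)
  have split: "as = take k as @ drop k as" by simp
  have n: "n = s + sum_list (drop k as)"
    using assms(1) k(3) unfolding is_composition_def
    by (metis append_take_drop_id sum_list_append)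
  have "take k as \<noteq> []" using k by auto
  then have hd: "hd (take k as) \<in> set (take k as)" by (rule hd_in_set)
  have pos: "\<forall>a\<in>set (take k as). 0 < a" "\<forall>a\<in>set (drop k as). 0 < a"
    using assms(1) unfolding is_composition_def
    by (meson in_set_takeD, meson in_set_dropD)
  have "0 < s" using k(3) hd pos(1) by (metis gr0I less_irrefl sum_list_eq_0_iff)
  moreover have "s < n" using n assms(3) by linarith
  ultimately show thesis
    using that[OF split] pos k(3) n by (simp add: is_composition_def)
qed

lemma PS_append_left: "as1 \<noteq> [] \<Longrightarrow> sum_list as1 \<in> PS (as1 @ as2)"
  by (auto simp: PS_def Suc_le_eq intro!: exI[of _ "length as1"])

lemma indecomposable_iff_PS:
  assumes "is_meander n lam mu" "0 < n"
  shows "indecomposable n lam mu \<longleftrightarrow> PS lam \<inter> PS mu = {n}"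
proof
  assume ind: "indecomposable n lam mu"
  have comps: "is_composition n lam" "is_composition n mu"
    using assms(1) by (auto simp: is_meander_def)
  then have s: "sum_list lam = n" "sum_list mu = n"
    by (simp_all add: is_composition_def)
  have ne: "lam \<noteq> []" "mu \<noteq> []"
    using s assms(2) by (metis less_irrefl sum_list.Nil)+
  have "n \<in> PS lam" "n \<in> PS mu"
    using PS_append_left[OF ne(1), of "[]"] PS_append_left[OF ne(2), of "[]"] s by simp_all
  moreover have "s = n" if sP: "s \<in> PS lam" "s \<in> PS mu" for s
  proof (rule ccontr)
    assume "s \<noteq> n"
    obtain l1 l2 where l: "lam = l1 @ l2" "is_composition s l1" "is_composition (n - s) l2"
      "0 < s" "s < n"
      using composition_split[OF comps(1) sP(1) \<open>s \<noteq> n\<close>] by blast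
    obtain m1 m2 where m: "mu = m1 @ m2" "is_composition s m1" "is_composition (n - s) m2"
      using composition_split[OF comps(2) sP(2) \<open>s \<noteq> n\<close>] by blast
    have "0 < n - s" "n = s + (n - s)" using l(4,5) by auto
    then show False
      using ind l(1-4) m unfolding indecomposable_def is_meander_def by blast
  qed
  ultimately show "PS lam \<inter> PS mu = {n}" by blast
next
  assume PS: "PS lam \<inter> PS mu = {n}"
  show "indecomposable n lam mu"
    unfolding indecomposable_def
  proof (rule notI, elim exE conjE)
    fix n1 n2 l1 l2 m1 m2
    assume h: "0 < n1" "0 < n2" "n = n1 + n2" "is_meander n1 l1 m1"
      "lam = l1 @ l2" "mu = m1 @ m2"
    have s1: "sum_list l1 = n1" "sum_list m1 = n1"
      using h(4) by (simp_all add: is_meander_def is_composition_def)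
    have "l1 \<noteq> []" "m1 \<noteq> []"
      using s1 h(1) by (metis less_irrefl sum_list.Nil)+
    then have "n1 \<in> PS lam \<inter> PS mu"
      using PS_append_left[of l1 l2] PS_append_left[of m1 m2] s1 unfolding h(5,6) by simp
    then show False using PS h(2,3) by simp
  qed
qed

definition Ibar :: "nat \<Rightarrow> nat \<Rightarrow> (nat list \<times> nat list) set" where
  "Ibar j n = {(lam, mu). is_meander n lam mu \<and> indecomposable n lam mu \<and>
                          set lam \<subseteq> {1, j} \<and> set mu \<subseteq> {1, j} \<and> hd lam > hd mu}"


section \<open>The multigraph and the index\<close>

text \<open>The edges contributed by a composition whose first part starts right after vertex \<open>p\<close>.
  An edge is a two-element vertex set; edges are collected in a multiset so that an upper edge
  and a lower edge with the same endpoints are kept separately.\<close>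

fun arcs_from :: "nat \<Rightarrow> nat list \<Rightarrow> nat set multiset" where
  "arcs_from p [] = {#}"
| "arcs_from p (a # as) =
     image_mset (\<lambda>i. {p + i, p + a + 1 - i}) (mset_set {1..a div 2}) + arcs_from (p + a) as"

definition meander_edges :: "nat list \<Rightarrow> nat list \<Rightarrow> nat set multiset" where
  "meander_edges lam mu = arcs_from 0 lam + arcs_from 0 mu"

definition meander_adj :: "nat list \<Rightarrow> nat list \<Rightarrow> (nat \<times> nat) set" where
  "meander_adj lam mu = {(u, v). {u, v} \<in># meander_edges lam mu}"

definition components :: "nat \<Rightarrow> nat list \<Rightarrow> nat list \<Rightarrow> nat set set" where
  "components n lam mu = {1..n} // (meander_adj lam mu)\<^sup>*"

definition induced_edges :: "nat list \<Rightarrow> nat list \<Rightarrow> nat set \<Rightarrow> nat set multiset" where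
  "induced_edges lam mu C = filter_mset (\<lambda>e. e \<subseteq> C) (meander_edges lam mu)"

text \<open>In both definitions the equation is one of multisets, so \<open>C\<close> carries exactly the listed
  edges. For \<open>length vs = 2\<close> the cycle is a double edge; for \<open>length vs = 1\<close> the path is an
  isolated vertex.\<close>

definition is_path_comp :: "nat list \<Rightarrow> nat list \<Rightarrow> nat set \<Rightarrow> bool" where
  "is_path_comp lam mu C \<longleftrightarrow>
     (\<exists>vs. vs \<noteq> [] \<and> distinct vs \<and> set vs = C \<and>
        induced_edges lam mu C =
          mset (map (\<lambda>i. {vs ! i, vs ! (i + 1)}) [0..<length vs - 1]))"

definition is_cycle_comp :: "nat list \<Rightarrow> nat list \<Rightarrow> nat set \<Rightarrow> bool" where
  "is_cycle_comp lam mu C \<longleftrightarrow>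
     (\<exists>vs. 2 \<le> length vs \<and> distinct vs \<and> set vs = C \<and>
        induced_edges lam mu C =
          mset (map (\<lambda>i. {vs ! i, vs ! ((i + 1) mod length vs)}) [0..<length vs]))"

definition meander_index :: "nat \<Rightarrow> nat list \<Rightarrow> nat list \<Rightarrow> nat" where
  "meander_index n lam mu =
     2 * card {C \<in> components n lam mu. is_cycle_comp lam mu C}
       + card {C \<in> components n lam mu. is_path_comp lam mu C}"


section \<open>Displacement lists\<close>

text \<open>A permutation of \<open>{1..m}\<close> is given in one-line notation, as the list
  \<open>[\<pi>\<^sub>1, \<dots>, \<pi>\<^sub>m]\<close>. List positions start at 0, so the entry at position \<open>i\<close> is
  \<open>\<pi>\<close> at \<open>i + 1\<close>.\<close>

definition displacement_list :: "nat list \<Rightarrow> int list" where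
  "displacement_list p = map (\<lambda>i. int (p ! i) - int (i + 1)) [0..<length p]"

definition N_odd :: "nat list \<Rightarrow> nat" where
  "N_odd p = length (filter odd (displacement_list p))"


section \<open>The map g\<close>

text \<open>Partially assigned displacement lists are lists of options; position \<open>i\<close> holds the
  displacement with index \<open>i + 1\<close>, and \<open>None\<close> means unassigned.\<close>

fun assign_first :: "int \<Rightarrow> int option list \<Rightarrow> int option list" where
  "assign_first x [] = []"
| "assign_first x (None # ds) = Some x # ds"
| "assign_first x (Some y # ds) = Some y # assign_first x ds"

definition g_init :: "nat \<Rightarrow> nat \<Rightarrow> nat list \<Rightarrow> nat list \<Rightarrow> int option list" where
  "g_init j n lam mu =
     map (\<lambda>i. if i = 1 then Some (int j - 2)
              else if i - 1 \<notin> PS lam \<union> PS mu then Some (- 2)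
              else None) [1..<n]"

text \<open>Instead of a tracker naming one of the two compositions, the loop carries the unread parts
  \<open>opp\<close> of the composition opposite the tracked one and the unread parts \<open>same\<close> of the tracked
  one. Reading a \<open>j\<close> moves the tracker to the composition just read, which exchanges the two
  roles. The last equation, where no part is left to read, is for totality only.\<close>

function (sequential) g_loop :: "nat \<Rightarrow> int option list \<Rightarrow> nat list \<Rightarrow> nat list \<Rightarrow> int option list" where
  "g_loop j ds (a # opp) same =
     (if None \<notin> set ds then ds
      else if a = 1 then g_loop j (assign_first (- 1) ds) opp same
      else g_loop j (assign_first (int j - 2) ds) same opp)"
| "g_loop j ds [] same = ds"
  by pat_completeness auto
termination
  by (relation "measure (\<lambda>(j, ds, opp, same). length opp + length same)") auto

definition g_displacements :: "nat \<Rightarrow> nat \<Rightarrow> nat list \<Rightarrow> nat list \<Rightarrow> int list" where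
  "g_displacements j n lam mu = map the (g_loop j (g_init j n lam mu) (tl mu) (tl lam))"

definition g :: "nat \<Rightarrow> nat \<Rightarrow> nat list \<Rightarrow> nat list \<Rightarrow> nat list" where
  "g j n lam mu =
     (let d = g_displacements j n lam mu
      in map (\<lambda>i. nat (d ! i + int (i + 1))) [0..<length d])"

end

theory Submission
  imports Defs
begin

text \<open>A vertex misses its upper (lower) edge exactly when it is the middle of an odd part of
  the upper (lower) composition, and a path accounts for two missing edges. So a meander without
  cycles has half as many paths as it has odd parts. The displacements \<open>- 1\<close> come from
  the parts \<open>1\<close> other than the first and the last one, those equal to \<open>j - 2\<close> from the parts
  \<open>j\<close>, and \<open>- 2\<close> is even, so the number of odd displacements is the number of odd parts
  minus \<open>2\<close>. What is left is that there are no cycles. If the smallest vertex of a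
  cycle lies in two blocks of length \<open>j\<close> starting at distance \<open>k\<close> from each other (\<open>k > 0\<close> by
  indecomposability), then following the two reflections translates it by \<open>2 * k\<close> until, for the given
  values of \<open>j\<close>, it meets the centre of a reflection or leaves the admissible range.\<close>

section \<open>Degrees in a multigraph\<close>

definition deg :: "'a set multiset \<Rightarrow> 'a \<Rightarrow> nat" where
  "deg E x = size (filter_mset (\<lambda>e. x \<in> e) E)"

lemma deg_union [simp]: "deg (E + F) x = deg E x + deg F x"
  by (simp add: deg_def)

text \<open>Handshake count on a union of components: an edge inside \<open>C\<close> is counted at
  both ends, any other edge not at all.\<close>

lemma sum_deg:
  assumes "finite C" "\<forall>e\<in>#E. card e = 2 \<and> (e \<subseteq> C \<or> e \<inter> C = {})"
  shows "(\<Sum>x\<in>C. deg E x) = 2 * size (filter_mset (\<lambda>e. e \<subseteq> C) E)"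
  using assms(2)
proof (induction E)
  case empty
  then show ?case by (simp add: deg_def)
next
  case (add e E)
  have "(\<Sum>x\<in>C. deg (add_mset e E) x) = (\<Sum>x\<in>C. deg E x + (if x \<in> e then 1 else 0))"
    by (rule sum.cong) (auto simp: deg_def)
  also have "\<dots> = (\<Sum>x\<in>C. deg E x) + card (C \<inter> e)"
    using assms(1) by (simp add: sum.distrib sum.If_cases Int_def)
  also have "card (C \<inter> e) = (if e \<subseteq> C then 2 else 0)"
  proof (cases "e \<subseteq> C")
    case True
    then show ?thesis using add.prems by (simp add: inf_absorb2)
  next
    case False
    then have "C \<inter> e = {}" using add.prems by auto
    then show ?thesis using False by simp
  qed
  finally show ?case using add by simp
qed

lemma three_neighbours_imp_deg_ge_3:
  assumes "{x, y} \<in># E" "{x, z} \<in># E" "{x, w} \<in># E" "y \<noteq> z" "y \<noteq> w" "z \<noteq> w"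
  shows "3 \<le> deg E x"
proof -
  let ?F = "filter_mset (\<lambda>e. x \<in> e) E"
  have "{{x, y}, {x, z}, {x, w}} \<subseteq> set_mset ?F" using assms by auto
  then have "card {{x, y}, {x, z}, {x, w}} \<le> card (set_mset ?F)"
    by (intro card_mono) auto
  moreover have "card {{x, y}, {x, z}, {x, w}} = 3"
    using assms(4-6) by (auto simp: card_insert_if doubleton_eq_iff)
  moreover have "card (set_mset ?F) \<le> size ?F"
    by (metis mset_set_set_mset_msubset size_mset_mono size_mset_set)
  ultimately show ?thesis by (simp add: deg_def)
qed

text \<open>Only the vertices are spanned: on a cycle the closing edge is left out. Absence of
  further edges is obtained later by counting.\<close>

lemma spanning_path:
  assumes fin: "finite C" and C: "C = R\<^sup>* `` {x0}" and sym: "sym R"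
    and deg2: "\<forall>x y z w. (x, y) \<in> R \<longrightarrow> (x, z) \<in> R \<longrightarrow> (x, w) \<in> R \<longrightarrow> y = z \<or> y = w \<or> z = w"
  shows "\<exists>vs. vs \<noteq> [] \<and> distinct vs \<and> set vs = C \<and>
    (\<forall>i. Suc i < length vs \<longrightarrow> (vs ! i, vs ! Suc i) \<in> R)"
proof -
  \<comment> \<open>A longest path in \<open>C\<close> contains all neighbours of its vertices.\<close>
  define P where "P vs \<longleftrightarrow> vs \<noteq> [] \<and> distinct vs \<and> set vs \<subseteq> C \<and>
    (\<forall>i. Suc i < length vs \<longrightarrow> (vs ! i, vs ! Suc i) \<in> R)" for vs
  have "P [x0]" by (auto simp: P_def C)
  moreover have "\<forall>vs. P vs \<longrightarrow> length vs < Suc (card C)"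
    using fin by (auto simp: P_def less_Suc_eq_le) (metis card_mono distinct_card)
  ultimately obtain vs where vs: "P vs" and max: "\<And>ws. P ws \<Longrightarrow> length ws \<le> length vs"
    using ex_has_greatest_nat[of P "[x0]" length "Suc (card C)"] by blast
  have step: "y \<in> set vs" if x: "x \<in> set vs" and xy: "(x, y) \<in> R" for x y
  proof (rule ccontr)
    assume y: "y \<notin> set vs"
    have "x \<in> C" using vs x by (auto simp: P_def)
    then have yC: "y \<in> C" using xy by (auto simp: C)
    obtain i where i: "i < length vs" "x = vs ! i" using x by (metis in_set_conv_nth)
    \<comment> \<open>At either end of the path \<open>y\<close> could be attached, contradicting
      maximality. So \<open>x\<close> is interior, and its predecessor, its successor and
      \<open>y\<close> are three neighbours.\<close>
    have "i \<noteq> 0"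
    proof
      assume 0: "i = 0"
      have yx: "(y, x) \<in> R" using sym xy by (rule symD)
      have "((y # vs) ! l, (y # vs) ! Suc l) \<in> R" if "Suc l < length (y # vs)" for l
        using that vs yx i 0 by (cases l) (auto simp: P_def)
      then have "P (y # vs)"
        using vs y yC by (auto simp: P_def)
      then show False using max by fastforce
    qed
    moreover have "Suc i \<noteq> length vs"
    proof
      assume last: "Suc i = length vs"
      have "((vs @ [y]) ! l, (vs @ [y]) ! Suc l) \<in> R" if "Suc l < length (vs @ [y])" for l
      proof (cases "Suc l < length vs")
        case True
        then show ?thesis using vs by (auto simp: P_def nth_append)
      next
        case False
        then have "l = i" using that last by simp
        then show ?thesis using xy i last by (simp add: nth_append)
      qed
      then have "P (vs @ [y])"
        using vs y yC by (auto simp: P_def)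
      then show False using max by fastforce
    qed
    ultimately obtain k where k: "i = Suc k" "Suc (Suc k) < length vs"
      using i by (cases i) auto
    have "(x, vs ! k) \<in> R" "(x, vs ! Suc (Suc k)) \<in> R"
      using vs k i symD[OF sym, of "vs ! k" x] by (auto simp: P_def)
    then have "vs ! k = vs ! Suc (Suc k) \<or> y = vs ! k \<or> y = vs ! Suc (Suc k)"
      using deg2 xy by metis
    then show False
      using vs y k by (auto simp: P_def nth_eq_iff_index_eq)
  qed
  obtain a where a: "a \<in> set vs" "a \<in> C" using vs by (metis P_def hd_in_set subsetD)
  have "y \<in> set vs" if "(a, y) \<in> R\<^sup>*" for y
    using that by (induction) (use a step in auto)
  moreover have "(a, y) \<in> R\<^sup>*" if "y \<in> C" for y
  proof -
    have "(a, x0) \<in> R\<^sup>*" using a(2) symD[OF sym_rtrancl[OF sym], of x0 a] by (simp add: C)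
    then show ?thesis using that by (auto simp: C)
  qed
  ultimately have "set vs = C" using vs by (auto simp: P_def)
  then show ?thesis using vs by (auto simp: P_def)
qed

section \<open>Arcs of a composition\<close>

lemma card_arc: "e \<in># arcs_from p as \<Longrightarrow> card e = 2"
  by (induction p as rule: arcs_from.induct) (auto simp: card_insert_if)

lemma arc_subset: "e \<in># arcs_from p as \<Longrightarrow> e \<subseteq> {p + 1..p + sum_list as}"
  by (induction p as rule: arcs_from.induct) fastforce+

text \<open>A part \<open>a\<close> carries \<open>a div 2\<close> arcs, covering all its vertices
  but the middle one when \<open>a\<close> is odd.\<close>

lemma size_arcs: "2 * size (arcs_from p as) + length (filter odd as) = sum_list as"
  by (induction p as rule: arcs_from.induct) (auto elim!: oddE)

lemma deg_arcs_outside: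
  assumes "x \<notin> {p + 1..p + sum_list as}"
  shows "deg (arcs_from p as) x = 0"
proof -
  have "x \<notin> e" if "e \<in># arcs_from p as" for e
    using arc_subset[OF that] assms by blast
  then show ?thesis by (auto simp: deg_def filter_mset_eq_conv)
qed

lemma deg_block:
  fixes p a x :: nat
  shows "deg (image_mset (\<lambda>i. {p + i, p + a + 1 - i}) (mset_set {1..a div 2})) x =
    (if p < x \<and> x \<le> p + a \<and> 2 * x \<noteq> 2 * p + a + 1 then 1 else 0)"
proof -
  let ?A = "{i \<in> {1..a div 2}. x = p + i \<or> x = p + a + 1 - i}"
  have "deg (image_mset (\<lambda>i. {p + i, p + a + 1 - i}) (mset_set {1..a div 2})) x = card ?A"
    by (simp add: deg_def filter_mset_image_mset)
  \<comment> \<open>The only possible arc index is the distance of \<open>x\<close> from the nearer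
    of \<open>p\<close> and \<open>p + a + 1\<close>; the centre has none.\<close>
  also have "?A = (if p < x \<and> x \<le> p + a \<and> 2 * x \<noteq> 2 * p + a + 1
      then {if 2 * x \<le> 2 * p + a then x - p else p + a + 1 - x} else {})"
  proof (intro set_eqI)
    fix i
    have "i \<le> a div 2 \<longleftrightarrow> 2 * i \<le> a" by linarith
    then show "i \<in> ?A \<longleftrightarrow> i \<in> (if p < x \<and> x \<le> p + a \<and> 2 * x \<noteq> 2 * p + a + 1
      then {if 2 * x \<le> 2 * p + a then x - p else p + a + 1 - x} else {})"
      by (simp split: if_splits) linarith
  qed
  finally show ?thesis by simp
qed

lemma deg_arcs:
  assumes "k < length as" "s = p + sum_list (take k as)" "s < x" "x \<le> s + as ! k"
  shows "deg (arcs_from p as) x = (if 2 * x = 2 * s + as ! k + 1 then 0 else 1)"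
  using assms
proof (induction as arbitrary: p k)
  case (Cons a as)
  show ?case
  proof (cases k)
    case 0
    then have "deg (arcs_from (p + a) as) x = 0"
      using Cons.prems by (intro deg_arcs_outside) auto
    then show ?thesis using Cons.prems 0 by (auto simp: deg_block simp del: One_nat_def)
  next
    case (Suc k')
    have "deg (arcs_from (p + a) as) x = (if 2 * x = 2 * s + as ! k' + 1 then 0 else 1)"
      using Cons.prems Suc by (intro Cons.IH) auto
    then show ?thesis using Cons.prems Suc by (auto simp: deg_block simp del: One_nat_def)
  qed
qed simp

text \<open>The arcs of a block are the two-element orbits of its reflection. This form, free of arc
  indices, is the one used to follow a cycle.\<close>

lemma arc_reflection:
  assumes "k < length as" "s = p + sum_list (take k as)" "s < x" "x \<le> s + as ! k"
    "2 * x \<noteq> 2 * s + as ! k + 1"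
  shows "{x, 2 * s + as ! k + 1 - x} \<in># arcs_from p as"
  using assms
proof (induction as arbitrary: p k)
  case (Cons a as)
  show ?case
  proof (cases k)
    case 0
    define i where "i = (if 2 * x \<le> 2 * p + a then x - p else p + a + 1 - x)"
    have "i \<in> {1..a div 2}" "{x, 2 * s + a + 1 - x} = {p + i, p + a + 1 - i}"
      using Cons.prems 0 by (auto simp: i_def)
    then show ?thesis using 0 by auto
  next
    case (Suc k')
    have "{x, 2 * s + as ! k' + 1 - x} \<in># arcs_from (p + a) as"
      using Cons.prems Suc by (intro Cons.IH) auto
    then show ?thesis using Suc by simp
  qed
qed simp

lemma block_of_vertex:
  fixes p x :: nat
  assumes "p < x" "x \<le> p + sum_list as"
  obtains k where "k < length as" "p + sum_list (take k as) < x"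
    "x \<le> p + sum_list (take k as) + as ! k"
proof -
  have "\<exists>k<length as. p + sum_list (take k as) < x \<and> x \<le> p + sum_list (take k as) + as ! k"
    using assms
  proof (induction as arbitrary: p)
    case (Cons a as)
    show ?case
    proof (cases "x \<le> p + a")
      case True
      then show ?thesis using Cons.prems by (intro exI[of _ 0]) auto
    next
      case False
      then have "p + a < x" "x \<le> p + a + sum_list as" using Cons.prems by auto
      from Cons.IH[OF this] obtain k where "k < length as" "p + a + sum_list (take k as) < x"
        "x \<le> p + a + sum_list (take k as) + as ! k"
        by blast
      then show ?thesis by (intro exI[of _ "Suc k"]) (auto simp: add.assoc)
    qed
  qed simp
  then show thesis using that by blast
qed

lemma deg_arcs_le_1: "deg (arcs_from p as) x \<le> 1"
proof (cases "x \<in> {p + 1..p + sum_list as}")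
  case True
  then obtain k where "k < length as" "p + sum_list (take k as) < x"
    "x \<le> p + sum_list (take k as) + as ! k"
    using block_of_vertex[of p x as] by auto
  from deg_arcs[OF this(1) refl this(2,3)] show ?thesis by simp
next
  case False
  then show ?thesis by (simp add: deg_arcs_outside)
qed


section \<open>Absence of cycles\<close>

text \<open>Chains of at most three reflections from the minimal vertex give linear conditions on
  \<open>t\<close> and \<open>k\<close>; their contradiction is a finite check over the listed
  \<open>j\<close>.\<close>

lemma no_reflection_cycle:
  fixes j s s' v :: nat
  assumes j: "j \<in> {2, 3, 4, 5, 7}" and ss': "s < s'"
    and v: "v \<in> C" "s' < v" "v \<le> s + j" and min: "\<And>x. x \<in> C \<Longrightarrow> v \<le> x"
    and up: "\<And>x. x \<in> C \<Longrightarrow> x \<le> s + j \<Longrightarrow> 2 * x \<noteq> 2 * s + j + 1 \<and> 2 * s + j + 1 - x \<in> C"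
    and lo: "\<And>x. x \<in> C \<Longrightarrow> x \<le> s + j \<Longrightarrow> 2 * x \<noteq> 2 * s' + j + 1 \<and> 2 * s' + j + 1 - x \<in> C"
  shows False
proof -
  define k where "k = s' - s"
  define P where "P t \<longleftrightarrow> s' + t \<in> C" for t
  have s': "s' = s + k" "1 \<le> k" using ss' by (auto simp: k_def)
  \<comment> \<open>The first block ends at coordinate \<open>j - k\<close>, where coordinates \<open>t\<close> are taken relative to \<open>s'\<close>.
    Minimality of \<open>v\<close> keeps reflections in the first block at positive coordinates.\<close>
  have U: "2 * t + 2 * k \<noteq> j + 1 \<and> t + 2 * k \<le> j \<and> P (j + 1 - 2 * k - t)"
    if "P t" "t + k \<le> j" for t
  proof -
    have "2 * (s' + t) \<noteq> 2 * s + j + 1" "2 * s + j + 1 - (s' + t) \<in> C"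
      using up[of "s' + t"] that s' by (auto simp: P_def)
    moreover from this have "s' < 2 * s + j + 1 - (s' + t)" using min v(2) by fastforce
    moreover from this have "2 * s + j + 1 - (s' + t) = s' + (j + 1 - 2 * k - t)" using s' by simp
    ultimately show ?thesis using s' by (auto simp: P_def)
  qed
  have L: "2 * t \<noteq> j + 1 \<and> P (j + 1 - t)" if "P t" "t + k \<le> j" for t
  proof -
    have "2 * (s' + t) \<noteq> 2 * s' + j + 1" "2 * s' + j + 1 - (s' + t) \<in> C"
      using lo[of "s' + t"] that s' by (auto simp: P_def)
    moreover have "2 * s' + j + 1 - (s' + t) = s' + (j + 1 - t)" using that s' by simp
    ultimately show ?thesis by (auto simp: P_def)
  qed
  define t where "t = v - s'"
  have t: "P t" "1 \<le> t" "t + k \<le> j" using v s' by (auto simp: t_def P_def)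
  note Ut = U[OF t(1,3)] and Lt = L[OF t(1,3)]
  \<comment> \<open>\<open>u\<close> is the reflection of \<open>t\<close> in the first block;
    reflecting it in the second gives \<open>t + 2 * k\<close>, the translation.\<close>
  define u where "u = j + 1 - 2 * k - t"
  have u: "P u" "u + k \<le> j" using Ut t(2) s'(2) by (auto simp: u_def)
  have Lu: "2 * u \<noteq> j + 1" "P (j + 1 - u)" using L[OF u] by auto
  have "j + 1 - u = t + 2 * k" using Ut t(2) by (auto simp: u_def)
  then have "t + 3 * k \<le> j \<longrightarrow> 2 * t + 6 * k \<noteq> j + 1 \<and> t + 4 * k \<le> j"
    using U[of "j + 1 - u"] Lu(2) by auto
  \<comment> \<open>The other order of reflections: \<open>k < t\<close> says that
    \<open>j + 1 - t\<close> still lies in the first block.\<close>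
  moreover have "k < t \<longrightarrow> 2 * (j + 1 - t) + 2 * k \<noteq> j + 1 \<and> j + 1 - t + 2 * k \<le> j"
    using U[of "j + 1 - t"] Lt t(3) by auto
  moreover have "2 * t + 2 * k \<noteq> j + 1" "t + 2 * k \<le> j" "2 * t \<noteq> j + 1"
    "2 * (j + 1 - 2 * k - t) \<noteq> j + 1"
    using Ut Lt Lu(1) by (auto simp: u_def)
  \<comment> \<open>The bounds \<open>t + 2 * k <= j <= 7\<close> and \<open>t, k >= 1\<close> leave
    these values.\<close>
  moreover from this t(2) s'(2) j have "k \<in> {1, 2, 3}" "t \<in> {1, 2, 3, 4, 5}" by auto
  ultimately show False using j by (elim insertE emptyE) simp_all
qed

text \<open>Turns degrees and edge-closure into the reflection conditions of
  \<open>no_reflection_cycle\<close>.\<close>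

lemma reflection_closed:
  assumes "set as \<subseteq> {1, j}" and C: "C \<subseteq> {1..sum_list as}" "v \<in> C"
    and deg: "\<forall>x\<in>C. deg (arcs_from 0 as) x = 1"
    and closed: "\<forall>x\<in>C. \<forall>y. {x, y} \<in># arcs_from 0 as \<longrightarrow> y \<in> C"
  shows "\<exists>k s. k < length as \<and> as ! k = j \<and> s = sum_list (take k as) \<and> s < v \<and> v \<le> s + j \<and>
    (\<forall>x\<in>C. s < x \<longrightarrow> x \<le> s + j \<longrightarrow> 2 * x \<noteq> 2 * s + j + 1 \<and> 2 * s + j + 1 - x \<in> C)"
proof -
  have "0 < v" "v \<le> 0 + sum_list as" using C by auto
  then obtain k where k: "k < length as" "0 + sum_list (take k as) < v"
    "v \<le> 0 + sum_list (take k as) + as ! k"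
    by (rule block_of_vertex)
  define s where "s = 0 + sum_list (take k as)"
  \<comment> \<open>A part \<open>1\<close> consists of its centre alone, where the degree is 0, so
    \<open>v\<close> lies in a block of length \<open>j\<close>.\<close>
  have "as ! k \<noteq> 1 \<or> as ! k = j" "as ! k \<in> {1, j}"
    using assms(1) k(1) bspec[OF deg C(2)] deg_arcs[OF k(1) refl k(2,3)] k(2,3) nth_mem by auto
  then have j: "as ! k = j" by blast
  have refl: "2 * x \<noteq> 2 * s + j + 1 \<and> 2 * s + j + 1 - x \<in> C"
    if "x \<in> C" "s < x" "x \<le> s + j" for x
    using deg_arcs[OF k(1) s_def, of x] arc_reflection[OF k(1) s_def, of x] that j deg closed
    by fastforce
  show ?thesis by (intro exI[of _ k] exI[of _ s]) (use k j refl s_def in auto)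
qed

lemma IbarE:
  assumes "(lam, mu) \<in> Ibar j n" "2 \<le> j"
  obtains l m where "lam = j # l" "mu = 1 # m" "set l \<subseteq> {1, j}" "set m \<subseteq> {1, j}"
    "sum_list lam = n" "sum_list mu = n" "PS lam \<inter> PS mu = {n}" "2 \<le> n"
proof -
  have mn: "is_meander n lam mu" and ind: "indecomposable n lam mu" and hd: "hd mu < hd lam"
    and sets: "set lam \<subseteq> {1, j}" "set mu \<subseteq> {1, j}"
    using assms(1) by (auto simp: Ibar_def)
  have sums: "sum_list lam = n" "sum_list mu = n" and pos: "0 \<notin> set lam" "0 \<notin> set mu"
    using mn by (auto simp: is_meander_def is_composition_def)
  \<comment> \<open>\<open>hd []\<close> is unspecified, so the sums are used: if one list were
    empty, so would be the other, and the heads would agree.\<close>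
  have "lam \<noteq> []" "mu \<noteq> []"
    using hd sums pos by (cases lam; cases mu; auto)+
  then obtain a l b m where lm: "lam = a # l" "mu = b # m" by (auto simp: neq_Nil_conv)
  with hd sets assms(2) have "a = j" "b = 1" by auto
  moreover have "2 \<le> n" using sums lm assms(2) \<open>a = j\<close> by auto
  ultimately show thesis
    using that lm sets sums indecomposable_iff_PS[OF mn] ind by auto
qed

lemma sum_list_take_in_PS: "0 < k \<Longrightarrow> k \<le> length as \<Longrightarrow> sum_list (take k as) \<in> PS as"
  by (auto simp: PS_def Suc_le_eq)

text \<open>Acyclicity is phrased through edge-closed sets so that it applies to components: on a
  cycle every degree is 2.\<close>

lemma Ibar_acyclic:
  assumes j: "j \<in> {2, 3, 4, 5, 7}" and I: "(lam, mu) \<in> Ibar j n"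
    and C: "C \<subseteq> {1..n}" "C \<noteq> {}"
    and closed: "\<And>x y. x \<in> C \<Longrightarrow> {x, y} \<in># meander_edges lam mu \<Longrightarrow> y \<in> C"
  shows "\<exists>x\<in>C. deg (meander_edges lam mu) x \<le> 1"
proof (rule ccontr)
  assume "\<not> ?thesis"
  then have "2 \<le> deg (meander_edges lam mu) x" if "x \<in> C" for x
    using that by fastforce
  then have "deg (arcs_from 0 lam) x = 1 \<and> deg (arcs_from 0 mu) x = 1" if "x \<in> C" for x
    using that deg_arcs_le_1[of 0 lam x] deg_arcs_le_1[of 0 mu x]
    by (fastforce simp: meander_edges_def)
  then have deg: "\<forall>x\<in>C. deg (arcs_from 0 lam) x = 1" "\<forall>x\<in>C. deg (arcs_from 0 mu) x = 1"
    by blast+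
  have j2: "2 \<le> j" using j by auto
  obtain l m where lm: "lam = j # l" "mu = 1 # m" "set l \<subseteq> {1, j}" "set m \<subseteq> {1, j}"
    "sum_list lam = n" "sum_list mu = n" and PS: "PS lam \<inter> PS mu = {n}"
    using IbarE[OF I j2] by metis
  have sub: "set lam \<subseteq> {1, j}" "set mu \<subseteq> {1, j}" "C \<subseteq> {1..sum_list lam}" "C \<subseteq> {1..sum_list mu}"
    using lm C(1) by auto
  have closed': "\<forall>x\<in>C. \<forall>y. {x, y} \<in># arcs_from 0 lam \<longrightarrow> y \<in> C"
    "\<forall>x\<in>C. \<forall>y. {x, y} \<in># arcs_from 0 mu \<longrightarrow> y \<in> C"
    using closed by (auto simp: meander_edges_def)
  define v where "v = Min C"
  have fin: "finite C" using C(1) finite_subset by blast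
  have v: "v \<in> C" "\<And>x. x \<in> C \<Longrightarrow> v \<le> x" using fin C(2) by (auto simp: v_def)
  obtain k s where s: "k < length lam" "lam ! k = j" "s = sum_list (take k lam)" "s < v" "v \<le> s + j"
    "\<And>x. x \<in> C \<Longrightarrow> s < x \<Longrightarrow> x \<le> s + j \<Longrightarrow> 2 * x \<noteq> 2 * s + j + 1 \<and> 2 * s + j + 1 - x \<in> C"
    using reflection_closed[OF sub(1,3) v(1) deg(1) closed'(1)] by blast
  obtain k' s' where s': "k' < length mu" "mu ! k' = j" "s' = sum_list (take k' mu)" "s' < v"
    "v \<le> s' + j"
    "\<And>x. x \<in> C \<Longrightarrow> s' < x \<Longrightarrow> x \<le> s' + j \<Longrightarrow> 2 * x \<noteq> 2 * s' + j + 1 \<and> 2 * s' + j + 1 - x \<in> C"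
    using reflection_closed[OF sub(2,4) v(1) deg(2) closed'(2)] by blast
  \<comment> \<open>\<open>mu\<close> begins with \<open>1\<close>, so a common start would be
    positive, hence a common partial sum below \<open>n\<close>.\<close>
  have "s \<noteq> s'"
  proof
    assume eq: "s = s'"
    have "k' \<noteq> 0" using s'(2) lm(2) j2 by (cases k') auto
    then have "0 < s'" using s'(3) lm(2) by (cases k') auto
    then have "k \<noteq> 0" using eq s(3) by (cases k) auto
    have "s \<in> PS lam" "s' \<in> PS mu"
      unfolding s(3) s'(3) by (rule sum_list_take_in_PS; use s s' \<open>k \<noteq> 0\<close> \<open>k' \<noteq> 0\<close> in simp)+
    then have "s = n" using PS eq by auto
    then show False using s(4) v(1) C(1) by auto
  qed
  then consider "s < s'" | "s' < s" by linarith
  then show False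
  proof cases
    case 1
    show False
    proof (rule no_reflection_cycle[OF j 1 v(1) s'(4) s(5) v(2)])
      fix x assume "x \<in> C" "x \<le> s + j"
      \<comment> \<open>Minimality gives \<open>s, s' < v <= x\<close>, and \<open>s < s'\<close>
        gives \<open>x <= s' + j\<close>, so \<open>x\<close> lies in both blocks.\<close>
      moreover from this have "v \<le> x" using v by simp
      ultimately show "2 * x \<noteq> 2 * s + j + 1 \<and> 2 * s + j + 1 - x \<in> C"
        "2 * x \<noteq> 2 * s' + j + 1 \<and> 2 * s' + j + 1 - x \<in> C"
        using s(6)[of x] s'(6)[of x] s(4) s'(4) 1 by auto
    qed
  next
    case 2
    show False
    proof (rule no_reflection_cycle[OF j 2 v(1) s(4) s'(5) v(2)])
      fix x assume "x \<in> C" "x \<le> s' + j"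
      moreover from this have "v \<le> x" using v by simp
      ultimately show "2 * x \<noteq> 2 * s + j + 1 \<and> 2 * s + j + 1 - x \<in> C"
        "2 * x \<noteq> 2 * s' + j + 1 \<and> 2 * s' + j + 1 - x \<in> C"
        using s(6)[of x] s'(6)[of x] s(4) s'(4) 2 by auto
    qed
  qed
qed

section \<open>The index of an acyclic meander\<close>

text \<open>The edges along a distinct list are pairwise distinct, so multiplicities are one and
  inclusion reduces to membership.\<close>

lemma mset_path_edges_subset:
  assumes "distinct vs" "\<And>i. Suc i < length vs \<Longrightarrow> {vs ! i, vs ! Suc i} \<in># M"
  shows "mset (map (\<lambda>i. {vs ! i, vs ! (i + 1)}) [0..<length vs - 1]) \<subseteq># M"
proof -
  let ?es = "map (\<lambda>i. {vs ! i, vs ! (i + 1)}) [0..<length vs - 1]"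
  have "inj_on (\<lambda>i. {vs ! i, vs ! (i + 1)}) {0..<length vs - 1}"
  proof (rule inj_onI)
    fix i k assume ik: "i \<in> {0..<length vs - 1}" "k \<in> {0..<length vs - 1}"
      and "{vs ! i, vs ! (i + 1)} = {vs ! k, vs ! (k + 1)}"
    then consider "vs ! i = vs ! k" | "vs ! i = vs ! (k + 1)" "vs ! (i + 1) = vs ! k"
      by (auto simp only: doubleton_eq_iff)
    then show "i = k"
      using ik nth_eq_iff_index_eq[OF assms(1)] by cases fastforce+
  qed
  then have "distinct ?es" by (simp add: distinct_map)
  then have "mset ?es = mset_set (set ?es)" by (rule mset_set_set[symmetric])
  also have "\<dots> \<subseteq># mset_set (set_mset M)"
  proof (rule subset_imp_msubset_mset_set)
    show "set ?es \<subseteq> set_mset M"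
    proof
      fix e assume "e \<in> set ?es"
      then obtain i where "e = {vs ! i, vs ! Suc i}" "Suc i < length vs" by auto
      then show "e \<in> set_mset M" using assms(2) by blast
    qed
  qed simp
  also have "\<dots> \<subseteq># M" by (rule mset_set_set_mset_msubset)
  finally show ?thesis .
qed

text \<open>Each component is a path with one edge fewer than vertices, so the number of components
  is \<open>n - size E\<close>; \<open>size_arcs\<close> then expresses \<open>size E\<close>
  through the odd parts.\<close>

lemma meander_index_acyclic:
  assumes mn: "is_meander n lam mu"
    and acyclic: "\<And>C. C \<subseteq> {1..n} \<Longrightarrow> C \<noteq> {} \<Longrightarrow>
      (\<And>x y. x \<in> C \<Longrightarrow> {x, y} \<in># meander_edges lam mu \<Longrightarrow> y \<in> C) \<Longrightarrow>
      \<exists>x\<in>C. deg (meander_edges lam mu) x \<le> 1"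
  shows "2 * meander_index n lam mu = length (filter odd lam) + length (filter odd mu)"
proof -
  define E where "E = meander_edges lam mu"
  define R where "R = meander_adj lam mu"
  have R_iff: "(x, y) \<in> R \<longleftrightarrow> {x, y} \<in># E" for x y
    by (simp add: R_def E_def meander_adj_def)
  have sums: "sum_list lam = n" "sum_list mu = n"
    using mn by (auto simp: is_meander_def is_composition_def)
  have E_sub: "e \<subseteq> {1..n}" and E_card: "card e = 2" if "e \<in># E" for e
    using that arc_subset[of e 0 lam] arc_subset[of e 0 mu] card_arc sums
    by (auto simp: E_def meander_edges_def)
  have deg2: "deg E x \<le> 2" for x
    using deg_arcs_le_1[of 0 lam x] deg_arcs_le_1[of 0 mu x] by (simp add: E_def meander_edges_def)
  have sym: "sym R" by (rule symI) (simp add: R_iff insert_commute)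
  have eqv: "equiv UNIV (R\<^sup>*)"
    by (intro equivI refl_rtrancl sym_rtrancl[OF sym] trans_rtrancl) auto
  have comp: "C \<subseteq> {1..n}" "finite C" "C \<noteq> {}" "is_path_comp lam mu C" "\<not> is_cycle_comp lam mu C"
    "(\<Sum>x\<in>C. deg E x) + 2 = 2 * card C"
    if CC: "C \<in> components n lam mu" for C
  proof -
    obtain x0 where x0: "x0 \<in> {1..n}" "C = R\<^sup>* `` {x0}"
      using CC by (auto simp: components_def quotient_def R_def)
    have "y \<in> {1..n}" if "(x0, y) \<in> R\<^sup>*" for y
      using that by induction (use x0 E_sub R_iff in \<open>auto simp: subset_iff\<close>)
    then show sub: "C \<subseteq> {1..n}" using x0 by auto
    then show fin: "finite C" using finite_subset by blast
    show ne: "C \<noteq> {}" using x0 by auto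
    have closed: "y \<in> C" if "x \<in> C" "{x, y} \<in># E" for x y
      using that x0 by (auto simp: R_iff[symmetric] intro: rtrancl_into_rtrancl)
    have "e \<subseteq> C \<or> e \<inter> C = {}" if e: "e \<in># E" for e
    proof -
      obtain x y where xy: "e = {x, y}" using E_card[OF e] by (auto simp: card_2_iff)
      then have "{x, y} \<in># E" "{y, x} \<in># E" using e by (auto simp: insert_commute)
      then show ?thesis using closed xy by blast
    qed
    then have sum: "(\<Sum>x\<in>C. deg E x) = 2 * size (induced_edges lam mu C)"
      using sum_deg[OF fin, of E] E_card by (simp add: induced_edges_def E_def)
    obtain z where z: "z \<in> C" "deg E z \<le> 1"
      using acyclic[OF sub ne] closed by (auto simp: E_def)
    \<comment> \<open>The vertex \<open>z\<close> pushes the degree sum below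
      \<open>2 * card C\<close>, so there are fewer edges than vertices.\<close>
    have "(\<Sum>x\<in>C. deg E x) < (\<Sum>x\<in>C. 2)"
    proof (rule sum_strict_mono_ex1[OF fin])
      show "\<forall>x\<in>C. deg E x \<le> 2" using deg2 by simp
      show "\<exists>x\<in>C. deg E x < 2" using z by (intro bexI[of _ z]) auto
    qed
    then have less: "size (induced_edges lam mu C) < card C" using sum by simp
    have nb: "\<forall>x y z w. (x, y) \<in> R \<longrightarrow> (x, z) \<in> R \<longrightarrow> (x, w) \<in> R \<longrightarrow> y = z \<or> y = w \<or> z = w"
    proof (intro allI impI)
      fix x y z w assume "(x, y) \<in> R" "(x, z) \<in> R" "(x, w) \<in> R"
      then show "y = z \<or> y = w \<or> z = w"
        using three_neighbours_imp_deg_ge_3[of x y E z w] deg2[of x] by (fastforce simp: R_iff)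
    qed
    obtain vs where vs: "vs \<noteq> []" "distinct vs" "set vs = C"
      "\<And>i. Suc i < length vs \<Longrightarrow> (vs ! i, vs ! Suc i) \<in> R"
      using spanning_path[OF fin x0(2) sym nb] by auto
    have len: "length vs = card C" using vs by (metis distinct_card)
    let ?L = "mset (map (\<lambda>i. {vs ! i, vs ! (i + 1)}) [0..<length vs - 1])"
    have "?L \<subseteq># induced_edges lam mu C"
    proof (rule mset_path_edges_subset[OF vs(2)])
      fix i assume i: "Suc i < length vs"
      then have "vs ! i \<in> C" "vs ! Suc i \<in> C" using vs(3) nth_mem[of i vs] nth_mem[of "Suc i" vs] by auto
      then show "{vs ! i, vs ! Suc i} \<in># induced_edges lam mu C"
        using vs(4)[OF i] by (simp add: R_iff induced_edges_def E_def)
    qed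
    \<comment> \<open>The spanning path already has \<open>card C - 1\<close> edges, so the
      inclusion is an equality.\<close>
    moreover have "size (induced_edges lam mu C) \<le> size ?L" using less len by simp
    ultimately have eq: "induced_edges lam mu C = ?L"
      by (metis mset_subset_size not_le subset_mset.le_less)
    then show "is_path_comp lam mu C" using vs by (auto simp: is_path_comp_def)
    show "\<not> is_cycle_comp lam mu C"
    proof
      assume "is_cycle_comp lam mu C"
      then obtain ws where "distinct ws" "set ws = C"
        "induced_edges lam mu C = mset (map (\<lambda>i. {ws ! i, ws ! ((i + 1) mod length ws)}) [0..<length ws])"
        by (auto simp: is_cycle_comp_def)
      then have "size (induced_edges lam mu C) = card C" by (auto simp: distinct_card)
      then show False using less by simp
    qed
    have "size (induced_edges lam mu C) = length vs - 1" unfolding eq by simp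
    then show "(\<Sum>x\<in>C. deg E x) + 2 = 2 * card C"
      using sum len vs(1) by (cases vs) auto
  qed
  have fincomp: "finite (components n lam mu)"
    by (rule finite_subset[of _ "Pow {1..n}"]) (use comp(1) in auto)
  have Un: "\<Union>(components n lam mu) = {1..n}"
  proof
    show "\<Union>(components n lam mu) \<subseteq> {1..n}" using comp(1) by blast
    show "{1..n} \<subseteq> \<Union>(components n lam mu)"
      by (auto simp: components_def quotient_def)
  qed
  \<comment> \<open>\<open>components\<close> is a quotient of \<open>{1..n}\<close> only;
    disjointness comes from the equivalence on all naturals.\<close>
  have "C \<in> UNIV // R\<^sup>*" if "C \<in> components n lam mu" for C
    using that by (auto simp: components_def quotient_def R_def)
  then have disj: "\<forall>A\<in>components n lam mu. \<forall>B\<in>components n lam mu. A \<noteq> B \<longrightarrow> A \<inter> B = {}"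
    using quotient_disj[OF eqv] by blast
  have split: "sum f {1..n} = (\<Sum>C\<in>components n lam mu. sum f C)" for f :: "nat \<Rightarrow> nat"
    using sum.Union_disjoint[OF _ disj, of f] comp(2) by (simp add: Un)
  have "{C \<in> components n lam mu. is_cycle_comp lam mu C} = {}"
    "{C \<in> components n lam mu. is_path_comp lam mu C} = components n lam mu"
    using comp(4,5) by auto
  then have idx: "meander_index n lam mu = card (components n lam mu)"
    unfolding meander_index_def by (simp only: card.empty mult_0_right add_0)
  have "(\<Sum>x\<in>{1..n}. deg E x) + 2 * card (components n lam mu) =
      (\<Sum>C\<in>components n lam mu. (\<Sum>x\<in>C. deg E x) + 2)"
    by (simp only: split sum.distrib) simp
  also have "\<dots> = (\<Sum>C\<in>components n lam mu. 2 * card C)"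
    using comp(6) by (intro sum.cong) auto
  also have "\<dots> = 2 * n"
    using split[of "\<lambda>_. 1"] by (simp flip: sum_distrib_left)
  finally have "(\<Sum>x\<in>{1..n}. deg E x) + 2 * card (components n lam mu) = 2 * n" .
  moreover have "(\<Sum>x\<in>{1..n}. deg E x) = 2 * size E"
  proof -
    have "filter_mset (\<lambda>e. e \<subseteq> {1..n}) E = E" using E_sub by (simp add: filter_mset_eq_conv)
    then show ?thesis using sum_deg[of "{1..n}" E] E_sub E_card by simp
  qed
  moreover have "2 * size E + length (filter odd lam) + length (filter odd mu) = 2 * n"
    using size_arcs[of 0 lam] size_arcs[of 0 mu] sums by (simp add: E_def meander_edges_def)
  ultimately show ?thesis using idx by simp
qed

section \<open>The map g\<close>

text \<open>Unassigned entries do not count, so each assignment changes the count by the parity of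
  its value.\<close>

definition odd_count :: "int option list \<Rightarrow> nat" where
  "odd_count ds = length (filter (\<lambda>z. \<exists>x. z = Some x \<and> odd x) ds)"

lemma odd_count_assign_first:
  "None \<in> set ds \<Longrightarrow> odd_count (assign_first x ds) = odd_count ds + (if odd x then 1 else 0)"
  by (induction x ds rule: assign_first.induct) (auto simp: odd_count_def)

lemma count_None_assign_first:
  "None \<in> set ds \<Longrightarrow> count_list ds None = Suc (count_list (assign_first x ds) None)"
  by (induction x ds rule: assign_first.induct) auto

lemma length_assign_first [simp]: "length (assign_first x ds) = length ds"
  by (induction x ds rule: assign_first.induct) auto

lemma assign_first_nth:
  "i < length ds \<Longrightarrow> assign_first x ds ! i = ds ! i \<or> assign_first x ds ! i = Some x"
  by (induction x ds arbitrary: i rule: assign_first.induct) (auto simp: nth_Cons split: nat.split)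

text \<open>Ensures that \<open>nat\<close> in \<open>g\<close> truncates nothing. The loop assigns
  only values \<open>>= -1\<close>, and position \<open>i\<close> stands for index
  \<open>i + 1\<close>.\<close>

lemma g_loop_nth_nonneg:
  assumes "1 \<le> j" "\<And>i x. i < length ds \<Longrightarrow> ds ! i = Some x \<Longrightarrow> 0 \<le> x + int i + 1"
    "i < length (g_loop j ds opp same)" "g_loop j ds opp same ! i = Some x"
  shows "0 \<le> x + int i + 1"
  using assms
proof (induction j ds opp same arbitrary: i x rule: g_loop.induct)
  case (1 j ds a opp same)
  have *: "0 \<le> x + int i + 1"
    if "i < length (assign_first y ds)" "assign_first y ds ! i = Some x" "-1 \<le> y" for i x y
    using that 1(4)[of i x] assign_first_nth[of i ds y] by fastforce
  consider "None \<notin> set ds" | "None \<in> set ds" "a = 1" | "None \<in> set ds" "a \<noteq> 1" by blast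
  then show ?case
  proof cases
    case 1
    then show ?thesis using "1.prems" by simp
  next
    case 2
    show ?thesis
      by (rule "1.IH"(1)[of i x]) (use 2 "1.prems" * in auto)
  next
    case 3
    show ?thesis
      by (rule "1.IH"(2)[of i x]) (use 3 "1.prems" *[of _ "int j - 2"] in auto)
  qed
qed simp

text \<open>\<open>P\<close> and \<open>Q\<close> are the ends of the parts read so far in the tracked and in the opposite
  composition; the last \<open>j\<close> read ends at \<open>P\<close> and starts before \<open>Q\<close>. Hence the opposite
  composition cannot run out of parts before the tracked one does.\<close>

lemma g_loop_correct:
  assumes "1 < j" "set opp \<subseteq> {1, j}" "set same \<subseteq> {1, j}" "Q < P" "P < Q + j"
    "Q + sum_list opp = n" "P + sum_list same = n"
    "\<And>i k. Q + sum_list (take i opp) = P + sum_list (take k same) \<Longrightarrow>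
      P + sum_list (take k same) = n"
    "Suc (count_list ds None) = length opp + length same"
  shows "None \<notin> set (g_loop j ds opp same) \<and>
    Suc (odd_count (g_loop j ds opp same)) =
      odd_count ds + length (filter odd opp) + length (filter odd same)"
  using assms
proof (induction j ds opp same arbitrary: P Q rule: g_loop.induct)
  case (1 j ds a opp same)
  note prems = "1.prems"
  have coincide: "P + sum_list (take k same) = n"
    if "Q + a + sum_list (take i opp) = P + sum_list (take k same)" for i k
    using prems(8)[of "Suc i" k] that by (simp add: add.assoc)
  show ?case
  proof (cases "None \<in> set ds")
    case False
    \<comment> \<open>With no entry open, only \<open>a\<close> is unread. It is \<open>1\<close>,
      as \<open>a = j\<close> would give \<open>P = n = Q + j\<close>; this is the leftover part,
      matched by the \<open>Suc\<close>.\<close>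
    then have "count_list ds None = 0" by (simp add: count_list_0_iff)
    then have "opp = []" "same = []" using prems(9) by auto
    then have "a = 1" using prems by auto
    then show ?thesis using False \<open>opp = []\<close> \<open>same = []\<close> by simp
  next
    case True
    note count = count_None_assign_first[OF True] and odds = odd_count_assign_first[OF True]
    have two: "1 \<le> length opp + length same"
      using prems(9) count[of 0] by simp
    show ?thesis
    proof (cases "a = 1")
      case a: True
      \<comment> \<open>Equality would be a common partial sum, hence \<open>n\<close>, yet an open
        entry requires an unread part besides \<open>a\<close>.\<close>
      have "Q + 1 \<noteq> P"
      proof
        assume "Q + 1 = P"
        then have "P = n" using coincide[of 0 0] a by simp
        then have "sum_list same = 0" "sum_list opp = 0"
          using prems(6,7) a \<open>Q + 1 = P\<close> by auto
        then have "same = []" "opp = []" using prems(1-3) by (cases same; cases opp; auto)+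
        then show False using two by simp
      qed
      then have "None \<notin> set (g_loop j (assign_first (-1) ds) opp same) \<and>
        Suc (odd_count (g_loop j (assign_first (-1) ds) opp same)) =
          odd_count (assign_first (-1) ds) + length (filter odd opp) + length (filter odd same)"
        by (intro "1.IH"(1)[of "Q + 1" P])
          (use True a prems coincide count[of "-1"] in auto)
      then show ?thesis using True a odds[of "-1"] by simp
    next
      case a: False
      then have aj: "a = j" using prems(2) by simp
      \<comment> \<open>The roles are exchanged: the tracked end becomes \<open>Q + j\<close>, the
        opposite end \<open>P\<close>, and \<open>P < Q + j < P + j\<close>.\<close>
      have "None \<notin> set (g_loop j (assign_first (int j - 2) ds) same opp) \<and>
        Suc (odd_count (g_loop j (assign_first (int j - 2) ds) same opp)) =
          odd_count (assign_first (int j - 2) ds) + length (filter odd same) + length (filter odd opp)"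
      proof (rule "1.IH"(2)[of P "Q + j"])
        fix i k assume eq: "P + sum_list (take i same) = Q + j + sum_list (take k opp)"
        then show "Q + j + sum_list (take k opp) = n" using coincide[of k i] aj by simp
      qed (use True a aj prems count[of "int j - 2"] in auto)
      then show ?thesis using True a aj odds[of "int j - 2"] by simp
    qed
  qed
next
  case (2 j ds same)
  \<comment> \<open>\<open>opp = []\<close> means \<open>Q = n\<close>, against
    \<open>Q < P <= n\<close>.\<close>
  then show ?case by auto
qed

section \<open>Partial sums and the entries left open by the initialisation\<close>

lemma PS_eq_image: "PS as = (\<lambda>k. sum_list (take k as)) ` {1..length as}"
  by (auto simp: PS_def)

lemma card_PS:
  assumes "0 \<notin> set as"
  shows "card (PS as) = length as"
proof -
  have less: "sum_list (take i as) < sum_list (take k as)" if "i < k" "k \<le> length as" for i k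
    using that
  proof (induction k)
    case (Suc k)
    have "as ! k \<noteq> 0" using Suc.prems assms nth_mem[of k as] by (metis Suc_le_eq)
    moreover have "sum_list (take i as) \<le> sum_list (take k as)"
      using Suc by (cases "i = k") auto
    ultimately show ?case using Suc.prems by (simp add: take_Suc_conv_app_nth)
  qed simp
  have "inj_on (\<lambda>k. sum_list (take k as)) {1..length as}"
    by (rule linorder_inj_onI) (use less in fastforce)+
  then show ?thesis by (simp add: PS_eq_image card_image)
qed

lemma PS_bounds:
  assumes "0 \<notin> set as" "x \<in> PS as"
  shows "1 \<le> x" "x \<le> sum_list as"
proof -
  obtain k where k: "1 \<le> k" "k \<le> length as" "x = sum_list (take k as)"
    using assms(2) by (auto simp: PS_def)
  have "sum_list as = x + sum_list (drop k as)"
    unfolding k(3) by (metis append_take_drop_id sum_list_append)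
  then show "x \<le> sum_list as" by simp
  have "hd as \<in> set (take k as)" "hd as \<in> set as" using k by (cases as; cases k; auto)+
  moreover from this have "hd as \<noteq> 0" using assms(1) by metis
  ultimately show "1 \<le> x" using member_le_sum_list[of "hd as" "take k as"] k(3) by simp
qed

lemma penultimate_in_PS:
  assumes "as \<noteq> []" "last as < sum_list as"
  shows "sum_list as - last as \<in> PS as"
proof -
  have as: "as = butlast as @ [last as]" using assms(1) by simp
  have "sum_list as = sum_list (butlast as) + last as" by (subst as) simp
  moreover from this have "butlast as \<noteq> []" using assms(2) by auto
  then have "sum_list (butlast as) \<in> PS as" using PS_append_left[of "butlast as" "[last as]"] as by simp
  ultimately show ?thesis by simp
qed

text \<open>Open entries have index \<open>m + 1\<close> for the partial sums \<open>m\<close> other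
  than \<open>n - 1\<close> and \<open>n\<close>. These two exclusions and the single shared partial
  sum \<open>n\<close> make up the 3.\<close>

lemma count_None_g_init:
  assumes I: "(lam, mu) \<in> Ibar j n" and j: "2 \<le> j"
  shows "count_list (g_init j n lam mu) None + 3 = length lam + length mu"
proof -
  obtain l m where lm: "lam = j # l" "mu = 1 # m" "set l \<subseteq> {1, j}" "set m \<subseteq> {1, j}"
    "sum_list lam = n" "sum_list mu = n" and PS: "PS lam \<inter> PS mu = {n}" and n: "2 \<le> n"
    using IbarE[OF I j] by metis
  have pos: "0 \<notin> set lam" "0 \<notin> set mu" using lm j by auto
  have fin: "finite (PS lam)" "finite (PS mu)" by (auto simp: PS_eq_image)
  let ?U = "PS lam \<union> PS mu"
  have cU: "card ?U + 1 = length lam + length mu"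
    using card_Un_Int[OF fin] PS card_PS[OF pos(1)] card_PS[OF pos(2)] by simp
  \<comment> \<open>Otherwise neither composition ends in \<open>1\<close>, both end in
    \<open>j\<close>, and \<open>n - j\<close> is a second common partial sum.\<close>
  have "n - 1 \<in> ?U"
  proof (rule ccontr)
    assume n1: "n - 1 \<notin> ?U"
    have last: "last lam \<in> set lam" "last mu \<in> set mu" using lm by auto
    have "last lam \<noteq> 1" "last mu \<noteq> 1"
      using n1 penultimate_in_PS[of lam] penultimate_in_PS[of mu] lm n by auto
    then have lj: "last lam = j" "last mu = j" using last lm by auto
    have "j < n"
    proof -
      have "m \<noteq> []" using lj(2) lm(2) j by auto
      then have "last mu \<in> set m" using lm(2) by auto
      then have "j \<le> sum_list m" using lj(2) member_le_sum_list by fastforce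
      then show ?thesis using lm by auto
    qed
    then have "n - j \<in> PS lam" "n - j \<in> PS mu"
      using penultimate_in_PS[of lam] penultimate_in_PS[of mu] lj lm by auto
    then have "n - j = n" using PS by blast
    then show False using \<open>j < n\<close> j by simp
  qed
  moreover have "n \<in> ?U" using PS by blast
  ultimately have cU2: "card (?U - {n - 1, n}) + 2 = card ?U"
    using fin n card_mono[of ?U "{n - 1, n}"] by (subst card_Diff_subset) auto
  have "count_list (g_init j n lam mu) None = card {i \<in> {1..<n}. i \<noteq> 1 \<and> i - 1 \<in> ?U}"
  proof -
    have "count_list (g_init j n lam mu) None =
        length (filter (\<lambda>i. i \<noteq> 1 \<and> i - 1 \<in> ?U) [1..<n])"
      unfolding g_init_def count_list_eq_length_filter filter_map length_map
      by (intro arg_cong[of _ _ length] filter_cong) auto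
    also have "\<dots> = card (set (filter (\<lambda>i. i \<noteq> 1 \<and> i - 1 \<in> ?U) [1..<n]))"
      by (rule distinct_card[symmetric]) simp
    also have "set (filter (\<lambda>i. i \<noteq> 1 \<and> i - 1 \<in> ?U) [1..<n]) = {i \<in> {1..<n}. i \<noteq> 1 \<and> i - 1 \<in> ?U}"
      by auto
    finally show ?thesis .
  qed
  \<comment> \<open>\<open>i < n\<close> excludes the partial sums \<open>n - 1\<close> and
    \<open>n\<close>; \<open>i \<noteq> 1\<close> excludes only 0, which is no partial sum.\<close>
  also have "{i \<in> {1..<n}. i \<noteq> 1 \<and> i - 1 \<in> ?U} = Suc ` (?U - {n - 1, n})"
  proof (intro set_eqI iffI)
    fix i assume "i \<in> {i \<in> {1..<n}. i \<noteq> 1 \<and> i - 1 \<in> ?U}"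
    then show "i \<in> Suc ` (?U - {n - 1, n})" by (intro image_eqI[of _ _ "i - 1"]) auto
  next
    fix i assume "i \<in> Suc ` (?U - {n - 1, n})"
    then obtain x where x: "i = Suc x" "x \<in> ?U" "x \<noteq> n - 1" "x \<noteq> n" by auto
    then have "1 \<le> x" "x \<le> n" using PS_bounds[OF pos(1)] PS_bounds[OF pos(2)] lm by auto
    then show "i \<in> {i \<in> {1..<n}. i \<noteq> 1 \<and> i - 1 \<in> ?U}" using x by auto
  qed
  finally have "count_list (g_init j n lam mu) None = card (?U - {n - 1, n})"
    by (simp add: card_image)
  then show ?thesis using cU cU2 by simp
qed

section \<open>Odd displacements against odd parts\<close>

lemma N_odd_g:
  assumes I: "(lam, mu) \<in> Ibar j n" and j: "2 \<le> j"
  shows "N_odd (g j n lam mu) + 2 = length (filter odd lam) + length (filter odd mu)"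
proof -
  obtain l m where lm: "lam = j # l" "mu = 1 # m" "set l \<subseteq> {1, j}" "set m \<subseteq> {1, j}"
    "sum_list lam = n" "sum_list mu = n" and PS: "PS lam \<inter> PS mu = {n}" and n: "2 \<le> n"
    using IbarE[OF I j] by metis
  define ds where "ds = g_init j n lam mu"
  define D where "D = g_loop j ds m l"
  have loop: "None \<notin> set D \<and> Suc (odd_count D) =
      odd_count ds + length (filter odd m) + length (filter odd l)"
    unfolding D_def
  \<comment> \<open>The parts read beforehand, \<open>1\<close> of \<open>mu\<close> and
    \<open>j\<close> of the tracked \<open>lam\<close>, give \<open>Q = 1\<close> and
    \<open>P = j\<close>.\<close>
  proof (rule g_loop_correct[of j m l 1 j n])
    fix i k assume eq: "1 + sum_list (take i m) = j + sum_list (take k l)"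
    \<comment> \<open>\<open>k\<close> may exceed the length of \<open>l\<close>; \<open>min\<close>
      brings the index into the range allowed by \<open>PS\<close>.\<close>
    have "j + sum_list (take k l) \<in> PS lam"
      using sum_list_take_in_PS[of "Suc (min k (length l))" lam] lm(1) by (cases "k \<le> length l") auto
    moreover have "1 + sum_list (take i m) \<in> PS mu"
      using sum_list_take_in_PS[of "Suc (min i (length m))" mu] lm(2) by (cases "i \<le> length m") auto
    ultimately show "j + sum_list (take k l) = n" using eq PS by auto
  next
    show "Suc (count_list ds None) = length m + length l"
      using count_None_g_init[OF I j] lm by (simp add: ds_def)
  qed (use lm j in auto)
  have ds: "ds = Some (int j - 2) # map (\<lambda>i. if i - 1 \<notin> PS lam \<union> PS mu then Some (- 2)
              else None) [2..<n]"
  proof -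
    have "[1..<n] = 1 # [2..<n]" using n by (simp add: upt_conv_Cons numeral_2_eq_2)
    then show ?thesis by (auto simp: ds_def g_init_def)
  qed
  have "odd_count ds = (if odd j then 1 else 0)"
    unfolding ds odd_count_def by (auto simp: filter_empty_conv)
  with loop have odds: "odd_count D + 2 = length (filter odd lam) + length (filter odd mu)"
    using lm by auto
  \<comment> \<open>The value \<open>-2\<close> first occurs at position 1, that is index 2, where
    the sum is still nonnegative.\<close>
  have dsn: "0 \<le> x + int i + 1" if "i < length ds" "ds ! i = Some x" for i x
    using that j by (cases i) (auto simp: ds split: if_splits)
  have nonneg: "0 \<le> the (D ! i) + int i + 1" if "i < length D" for i
  proof -
    have "D ! i = Some (the (D ! i))" using loop that nth_mem[of i D] by (cases "D ! i") auto
    then show ?thesis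
      using g_loop_nth_nonneg[of j ds i m l "the (D ! i)"] that j dsn unfolding D_def by simp
  qed
  have d: "g_displacements j n lam mu = map the D"
    by (simp add: g_displacements_def D_def ds_def lm)
  have "displacement_list (g j n lam mu) = map the D"
    by (rule nth_equalityI)
      (use nonneg in \<open>auto simp: displacement_list_def g_def d Let_def algebra_simps\<close>)
  then have "N_odd (g j n lam mu) = length (filter (\<lambda>z. odd (the z)) D)"
    by (simp add: N_odd_def filter_map comp_def)
  also have "filter (\<lambda>z. odd (the z)) D = filter (\<lambda>z. \<exists>x. z = Some x \<and> odd x) D"
    proof (rule filter_cong[OF refl])
    fix z assume z: "z \<in> set D"
    show "odd (the z) \<longleftrightarrow> (\<exists>x. z = Some x \<and> odd x)" by (cases z) (use loop z in auto)
  qed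
  finally show ?thesis using odds by (simp add: odd_count_def)
qed

theorem theorem6p11:
  fixes j n :: nat and lam mu p :: "nat list"
  assumes "j \<in> {2, 3, 4, 5, 7}"
    and "(lam, mu) \<in> Ibar j n"
    and "p = g j n lam mu"
  shows "real (meander_index n lam mu) = real (N_odd p) / 2 + 1"
proof -
  have "is_meander n lam mu" using assms(2) by (simp add: Ibar_def)
  then have "2 * meander_index n lam mu = length (filter odd lam) + length (filter odd mu)"
    by (rule meander_index_acyclic) (rule Ibar_acyclic[OF assms(1,2)])
  also have "\<dots> = N_odd p + 2"
    using N_odd_g[OF assms(2)] assms(1,3) by auto
  finally show ?thesis by simp
qed

end
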